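(* Let $X$ be a compact metrizable space with a free interval $J$. Then there are no ToM-systems on $X$, i.e. there is no continuous map $f:X\to X$ such that $(X,f)$ is a ToM-system.
   Context: A free interval of a topological space $X$ is an open subset of $X$ homeomorphic to an open interval of the real line. A continuous $f:X\to X$ is transitive if for all nonempty open $U,V\subseteq X$ there is $n\ge 1$ with $f^n(U)\cap V\neq\emptyset$; it is minimal if every orbit $\{f^n(x):n\ge0\}$ is dense. A point is transitive if its orbit is dense in $X$. A set $M\subseteq X$ is a minimal set if it is nonempty, closed, $f(M)\subseteq M$ and every orbit of a point of $M$ is dense in $M$; a point is minimal if it belongs to a minimal set. $(X,f)$ is a ToM-system if $X$ is a compact metrizable space, $f$ is (continuous and) transitive, not minimal, and every point of $X$ is either transitive or minimal. *)

theory Defs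
  imports "HOL-Analysis.Analysis"
begin

text \<open>Open intervals of the real line may be unbounded, but are required to be nonempty.\<close>

definition free_interval :: "'a topology \<Rightarrow> 'a set \<Rightarrow> bool" where
  "free_interval X J \<longleftrightarrow> openin X J \<and>
     (\<exists>I::real set. open I \<and> is_interval I \<and> I \<noteq> {} \<and>
        subtopology X J homeomorphic_space top_of_set I)"

definition orbit_of :: "('a \<Rightarrow> 'a) \<Rightarrow> 'a \<Rightarrow> 'a set" where
  "orbit_of f x = {(f ^^ n) x |n. True}"

definition dense_set :: "'a topology \<Rightarrow> 'a set \<Rightarrow> bool" where
  "dense_set X S \<longleftrightarrow> S \<subseteq> topspace X \<and> X closure_of S = topspace X"

text \<open>The dynamical notions below are meant for maps \<open>f\<close> that are continuous from the space
  \<open>X\<close> to itself; this requirement is part of the definition of a ToM-system.\<close>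

definition transitive_map :: "'a topology \<Rightarrow> ('a \<Rightarrow> 'a) \<Rightarrow> bool" where
  "transitive_map X f \<longleftrightarrow>
     (\<forall>U V. openin X U \<and> U \<noteq> {} \<and> openin X V \<and> V \<noteq> {} \<longrightarrow>
        (\<exists>n\<ge>1. (f ^^ n) ` U \<inter> V \<noteq> {}))"

definition minimal_map :: "'a topology \<Rightarrow> ('a \<Rightarrow> 'a) \<Rightarrow> bool" where
  "minimal_map X f \<longleftrightarrow> (\<forall>x\<in>topspace X. dense_set X (orbit_of f x))"

definition transitive_point :: "'a topology \<Rightarrow> ('a \<Rightarrow> 'a) \<Rightarrow> 'a \<Rightarrow> bool" where
  "transitive_point X f x \<longleftrightarrow> x \<in> topspace X \<and> dense_set X (orbit_of f x)"

definition minimal_set :: "'a topology \<Rightarrow> ('a \<Rightarrow> 'a) \<Rightarrow> 'a set \<Rightarrow> bool" where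
  "minimal_set X f M \<longleftrightarrow> M \<noteq> {} \<and> closedin X M \<and> f ` M \<subseteq> M \<and>
     (\<forall>x\<in>M. dense_set (subtopology X M) (orbit_of f x))"

definition minimal_point :: "'a topology \<Rightarrow> ('a \<Rightarrow> 'a) \<Rightarrow> 'a \<Rightarrow> bool" where
  "minimal_point X f x \<longleftrightarrow> (\<exists>M. minimal_set X f M \<and> x \<in> M)"

definition ToM_system :: "'a topology \<Rightarrow> ('a \<Rightarrow> 'a) \<Rightarrow> bool" where
  "ToM_system X f \<longleftrightarrow>
     compact_space X \<and> metrizable_space X \<and> continuous_map X X f \<and>
     transitive_map X f \<and> \<not> minimal_map X f \<and>
     (\<forall>x\<in>topspace X. transitive_point X f x \<or> minimal_point X f x)"

end

theory Submission
  imports Defs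
begin

text \<open>Transitive points are forward invariant, and in a ToM-system this forces every minimal set to
  be backward invariant. Compactness shows that if all points of some nonempty open set were
  transitive, the map would be minimal; hence minimal points are dense. Now take a minimal set
  \<open>A\<close> meeting the free interval and two minimal points \<open>b < c\<close> in it such that \<open>[b, c]\<close> misses \<open>A\<close>.
  A small interval \<open>E\<close> around a point of \<open>A\<close> misses the minimal sets of \<open>b\<close> and \<open>c\<close>, and some
  iterate \<open>f\<^sup>n(E)\<close> meets \<open>(b, c)\<close> by transitivity. Being connected and avoiding \<open>b\<close> and \<open>c\<close> by
  backward invariance, \<open>f\<^sup>n(E)\<close> is contained in \<open>(b, c)\<close>, yet it meets \<open>A\<close>.\<close>

lemma continuous_map_funpow:
  assumes "continuous_map X X f"
  shows "continuous_map X X (f ^^ n)"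
proof (induction n)
  case 0
  then show ?case by (simp add: id_def)
next
  case (Suc n)
  show ?case unfolding funpow.simps using continuous_map_compose[OF Suc assms] .
qed

lemma funpow_mem:
  assumes "f ` M \<subseteq> M" "x \<in> M"
  shows "(f ^^ n) x \<in> M"
  using assms by (induction n) auto

lemma orbit_of_rec: "orbit_of f x = insert x (orbit_of f (f x))"
proof -
  have "(f ^^ n) x = x \<or> (\<exists>m. (f ^^ n) x = (f ^^ m) (f x))" for n
    by (cases n) (auto simp: funpow_swap1)
  moreover have "\<exists>n. x = (f ^^ n) x" by (rule exI[of _ 0]) simp
  moreover have "\<exists>n. (f ^^ m) (f x) = (f ^^ n) x" for m
    by (rule exI[of _ "Suc m"]) (simp add: funpow_swap1)
  ultimately show ?thesis unfolding orbit_of_def set_eq_iff insert_iff mem_Collect_eq by metis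
qed

lemma orbit_of_subset:
  assumes "f ` M \<subseteq> M" "x \<in> M"
  shows "orbit_of f x \<subseteq> M"
  using funpow_mem[OF assms] by (auto simp: orbit_of_def)

text \<open>Dropping \<open>x\<close> from its own orbit can remove at most \<open>x\<close> from
  the closure, because singletons are closed. If \<open>x\<close> were lost, it would be isolated;
  transitivity applied to the open set \<open>{x}\<close> twice then makes \<open>x\<close>
  periodic, which puts \<open>x\<close> back into the orbit of \<open>f x\<close>.\<close>

lemma transitive_point_image:
  assumes "t1_space X" "continuous_map X X f" "transitive_map X f" "transitive_point X f x"
  shows "transitive_point X f (f x)"
proof -
  have x: "x \<in> topspace X" and dx: "X closure_of orbit_of f x = topspace X"
    using assms(4) by (auto simp: transitive_point_def dense_set_def)
  have inv: "f ` topspace X \<subseteq> topspace X"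
    using assms(2) by (simp add: continuous_map_image_subset_topspace)
  have fx: "f x \<in> topspace X" using inv x by auto
  let ?S = "X closure_of orbit_of f (f x)"
  have cl: "closedin X {x}" using assms(1) x by (simp add: closedin_t1_singleton)
  have "topspace X = X closure_of (insert x (orbit_of f (f x)))"
    using dx orbit_of_rec by metis
  also have "\<dots> = X closure_of {x} \<union> ?S"
    by (metis closure_of_Un insert_is_Un)
  finally have top: "topspace X = insert x ?S" using cl by (simp add: closure_of_closedin)
  have sub: "orbit_of f (f x) \<subseteq> topspace X" using orbit_of_subset[OF inv fx] .
  have "x \<in> ?S"
  proof (rule ccontr)
    assume "x \<notin> ?S"
    then have "topspace X - ?S = {x}" using top by auto
    then have "openin X {x}" by (metis closedin_closure_of openin_diff openin_topspace)
    then have "\<exists>n\<ge>1. (f ^^ n) ` {x} \<inter> {x} \<noteq> {}"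
      using assms(3) unfolding transitive_map_def by blast
    then obtain n where "n \<ge> 1" "(f ^^ n) x = x" by auto
    then have "(f ^^ (n - 1)) (f x) = x"
      by (cases n) (simp_all add: funpow_swap1)
    then have "x \<in> orbit_of f (f x)" unfolding orbit_of_def mem_Collect_eq by metis
    with \<open>x \<notin> ?S\<close> closure_of_subset[OF sub] show False by auto
  qed
  with top sub fx show ?thesis by (auto simp: transitive_point_def dense_set_def)
qed

text \<open>The orbit of the common point \<open>x\<close> is dense in \<open>M\<close> and cannot
  leave the closed invariant set \<open>M'\<close>. By symmetry, minimal sets that meet
  coincide.\<close>

lemma minimal_set_subset:
  assumes "minimal_set X f M" "minimal_set X f M'" "x \<in> M" "x \<in> M'"
  shows "M \<subseteq> M'"
proof -
  have "orbit_of f x \<subseteq> M'" using assms orbit_of_subset unfolding minimal_set_def by metis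
  then have "X closure_of orbit_of f x \<subseteq> M'"
    using assms(2) closure_of_minimal unfolding minimal_set_def by metis
  moreover have "M \<subseteq> X closure_of orbit_of f x"
  proof -
    have "M \<subseteq> topspace X" using assms(1) closedin_subset unfolding minimal_set_def by blast
    moreover have "dense_set (subtopology X M) (orbit_of f x)"
      using assms(1,3) by (simp add: minimal_set_def)
    ultimately have "M \<subseteq> X closure_of (M \<inter> orbit_of f x)"
      unfolding dense_set_def closure_of_subtopology topspace_subtopology by blast
    also have "\<dots> \<subseteq> X closure_of orbit_of f x"
      by (rule closure_of_mono) blast
    finally show ?thesis .
  qed
  ultimately show ?thesis by blast
qed

text \<open>A dense orbit inside the closed invariant set \<open>M\<close> would force
  \<open>M\<close> to be the whole space, and minimality of \<open>M\<close> would become minimality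
  of \<open>f\<close>.\<close>

lemma minimal_set_not_transitive:
  assumes "\<not> minimal_map X f" "minimal_set X f M" "x \<in> M"
  shows "\<not> transitive_point X f x"
proof
  assume t: "transitive_point X f x"
  have "orbit_of f x \<subseteq> M" using assms orbit_of_subset unfolding minimal_set_def by metis
  then have "topspace X \<subseteq> M"
    using assms(2) t closure_of_minimal
    unfolding minimal_set_def transitive_point_def dense_set_def by metis
  then have "M = topspace X" using assms(2) closedin_subset unfolding minimal_set_def by blast
  then have "minimal_map X f" using assms(2) by (simp add: minimal_set_def minimal_map_def)
  with assms(1) show False ..
qed

lemma ToM_system_t1_space: "ToM_system X f \<Longrightarrow> t1_space X"
  by (simp add: ToM_system_def Hausdorff_imp_t1_space metrizable_imp_Hausdorff_space)

text \<open>Since \<open>f x\<close> lies in a minimal set, it is not transitive, so neither is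
  \<open>x\<close>. The dichotomy for points places \<open>x\<close> in some minimal set
  \<open>M'\<close>; it shares \<open>f x\<close> with \<open>M\<close>, hence lies inside
  \<open>M\<close>. Induction extends this to iterates.\<close>

lemma minimal_set_vimage:
  assumes "ToM_system X f" "minimal_set X f M" "x \<in> topspace X" "(f ^^ n) x \<in> M"
  shows "x \<in> M"
  using assms(3,4)
proof (induction n arbitrary: x)
  case 0
  then show ?case by simp
next
  case (Suc n)
  have cont: "continuous_map X X f" and tr: "transitive_map X f" and nm: "\<not> minimal_map X f"
    and tm: "\<And>x. x \<in> topspace X \<Longrightarrow> transitive_point X f x \<or> minimal_point X f x"
    using assms(1) by (auto simp: ToM_system_def)
  have "f x \<in> topspace X"
    using continuous_map_image_subset_topspace[OF cont] Suc.prems(1) by auto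
  moreover have "(f ^^ n) (f x) \<in> M" using Suc.prems(2) by (simp add: funpow_swap1)
  ultimately have fx: "f x \<in> M" by (rule Suc.IH)
  then have "\<not> transitive_point X f (f x)" using minimal_set_not_transitive[OF nm assms(2)] by simp
  then have "\<not> transitive_point X f x"
    using transitive_point_image[OF ToM_system_t1_space[OF assms(1)] cont tr] by blast
  then obtain M' where M': "minimal_set X f M'" "x \<in> M'"
    using tm Suc.prems(1) by (auto simp: minimal_point_def)
  then have "f x \<in> M'" by (auto simp: minimal_set_def)
  with minimal_set_subset[OF M'(1) assms(2)] fx M'(2) show ?case by blast
qed

text \<open>If \<open>U\<close> had only transitive points, compactness would bound the return times
  to a closed \<open>K\<close> inside \<open>U\<close>. Finitely many images of \<open>K\<close>
  would then contain a dense orbit and, being closed, cover the space. Every point would be an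
  iterate of a transitive point, making \<open>f\<close> minimal.\<close>

lemma nontransitive_points_dense:
  assumes tom: "ToM_system X f" and U: "openin X U" "U \<noteq> {}"
  shows "\<exists>x\<in>U. \<not> transitive_point X f x"
proof (rule ccontr)
  assume "\<not> ?thesis"
  then have UT: "\<And>x. x \<in> U \<Longrightarrow> transitive_point X f x" by blast
  have comp: "compact_space X" and met: "metrizable_space X" and cont: "continuous_map X X f"
    and tr: "transitive_map X f" and nm: "\<not> minimal_map X f"
    using tom by (auto simp: ToM_system_def)
  note img = transitive_point_image[OF ToM_system_t1_space[OF tom] cont tr]
  have haus: "Hausdorff_space X" using met by (rule metrizable_imp_Hausdorff_space)
  have "neighbourhood_base_of (closedin X) X"
    using metrizable_imp_regular_space[OF met] by (simp add: neighbourhood_base_of_closedin)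
  moreover obtain x0 where "x0 \<in> U" using U by blast
  ultimately obtain V K where VK: "openin X V" "closedin X K" "x0 \<in> V" "V \<subseteq> K" "K \<subseteq> U"
    using U(1) unfolding neighbourhood_base_of by metis
  have KT: "\<And>x. x \<in> K \<Longrightarrow> transitive_point X f x" using UT VK by blast
  have Kc: "compactin X K" using comp VK(2) by (simp add: closedin_compact_space)
  \<comment> \<open>Returning to \<open>V\<close> rather than to \<open>K\<close> makes each
    \<open>P n\<close> open; the \<open>Suc\<close> makes the return time positive.\<close>
  define P where "P n = {x \<in> topspace X. (f ^^ Suc n) x \<in> V}" for n
  have opP: "openin X (P n)" for n
    unfolding P_def by (rule openin_continuous_map_preimage[OF continuous_map_funpow[OF cont] VK(1)])
  have "K \<subseteq> \<Union> (range P)"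
  proof
    fix x assume x: "x \<in> K"
    \<comment> \<open>Density of the orbit of \<open>f x\<close>, instead of \<open>x\<close>,
      yields a visit to \<open>V\<close> at a positive time.\<close>
    have "x \<in> topspace X" and dx: "X closure_of orbit_of f (f x) = topspace X"
      using img[OF KT[OF x]] KT[OF x] by (auto simp: transitive_point_def dense_set_def)
    have "x0 \<in> X closure_of orbit_of f (f x)"
      unfolding dx using openin_subset[OF VK(1)] VK(3) by blast
    then obtain y where "y \<in> orbit_of f (f x)" "y \<in> V"
      using VK(1,3) unfolding in_closure_of by blast
    then obtain n where "(f ^^ n) (f x) \<in> V" by (auto simp: orbit_of_def)
    then have "x \<in> P n" using \<open>x \<in> topspace X\<close> by (simp add: P_def funpow_swap1)
    then show "x \<in> \<Union> (range P)" by blast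
  qed
  then obtain \<F> where F: "finite \<F>" "\<F> \<subseteq> range P" "K \<subseteq> \<Union>\<F>"
    using compactinD[OF Kc, of "range P"] opP by blast
  then obtain T where T: "finite T" "\<F> = P ` T" by (metis finite_subset_image)
  \<comment> \<open>The outer \<open>Suc\<close> matches the return time \<open>Suc n\<close> of
    \<open>P n\<close>; the inserted \<open>0\<close> covers an empty \<open>T\<close>.\<close>
  define N where "N = Suc (Max (insert 0 T))"
  have ret: "\<exists>n\<ge>1. n \<le> N \<and> (f ^^ n) x \<in> K" if x: "x \<in> K" for x
  proof -
    obtain n where n: "n \<in> T" "x \<in> P n" using F(3) T(2) x by blast
    then have "Suc n \<le> N" using T(1) by (simp add: N_def)
    with n(2) VK(4) show ?thesis by (intro exI[of _ "Suc n"]) (auto simp: P_def)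
  qed
  define Y where "Y = (\<Union>i\<in>{..N}. (f ^^ i) ` K)"
  have inY: "(f ^^ m) x \<in> Y" if "x \<in> K" for m x
    using that
  \<comment> \<open>A time beyond \<open>N\<close> is shortened by restarting at the first known
    return to \<open>K\<close>; this decreases \<open>m\<close> because
    \<open>n \<ge> 1\<close>.\<close>
  proof (induction m arbitrary: x rule: less_induct)
    case (less m)
    show ?case
    proof (cases "m \<le> N")
      case True
      then show ?thesis using less.prems by (auto simp: Y_def)
    next
      case False
      obtain n where n: "n \<ge> 1" "n \<le> N" "(f ^^ n) x \<in> K" using ret[OF less.prems] by blast
      have "(f ^^ (m - n)) ((f ^^ n) x) \<in> Y" using n False by (intro less.IH) auto
      moreover have "(f ^^ (m - n)) ((f ^^ n) x) = (f ^^ m) x"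
        using n False funpow_add[of "m - n" n f] by simp
      ultimately show ?thesis by simp
    qed
  qed
  have "closedin X Y" unfolding Y_def
    by (intro closedin_Union)
       (auto intro!: compactin_imp_closedin[OF haus] image_compactin[OF Kc] continuous_map_funpow cont)
  moreover have x0K: "x0 \<in> K" using VK by blast
  then have "orbit_of f x0 \<subseteq> Y" using inY by (auto simp: orbit_of_def)
  ultimately have "topspace X \<subseteq> Y"
    using KT[OF x0K] closure_of_minimal unfolding transitive_point_def dense_set_def by metis
  have funT: "transitive_point X f ((f ^^ i) k)" if "k \<in> K" for i k
    using KT[OF that] img by (induction i) auto
  have "minimal_map X f"
    unfolding minimal_map_def
  proof
    fix y assume "y \<in> topspace X"
    then obtain i k where "k \<in> K" "y = (f ^^ i) k" using \<open>topspace X \<subseteq> Y\<close> by (auto simp: Y_def)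
    then show "dense_set X (orbit_of f y)" using funT by (simp add: transitive_point_def)
  qed
  with nm show False ..
qed

text \<open>Supplies the minimal points that are picked below in prescribed open pieces of the free
  interval.\<close>

lemma nontransitive_in_minimal_set:
  assumes "ToM_system X f" "openin X U" "U \<noteq> {}"
  obtains x M where "x \<in> U" "minimal_set X f M" "x \<in> M"
proof -
  obtain x where x: "x \<in> U" "\<not> transitive_point X f x"
    using nontransitive_points_dense[OF assms] by blast
  then have "minimal_point X f x" using assms openin_subset by (fastforce simp: ToM_system_def)
  with x(1) that show thesis by (auto simp: minimal_point_def)
qed

theorem corollary30:
  fixes X :: "'a topology" and J :: "'a set"
  assumes "compact_space X"
    and "metrizable_space X"
    and "free_interval X J"
  shows "\<not> (\<exists>f. continuous_map X X f \<and> ToM_system X f)"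
proof
  assume "\<exists>f. continuous_map X X f \<and> ToM_system X f"
  then obtain f where cont: "continuous_map X X f" and tom: "ToM_system X f" by blast
  have haus: "Hausdorff_space X" using assms(2) by (rule metrizable_imp_Hausdorff_space)
  have trans: "transitive_map X f" and nm: "\<not> minimal_map X f" using tom by (auto simp: ToM_system_def)
  obtain I :: "real set" where J: "openin X J" and I: "open I" "is_interval I" "I \<noteq> {}"
    and "subtopology X J homeomorphic_space top_of_set I"
    using assms(3) unfolding free_interval_def by blast
  then obtain g where g: "homeomorphic_map (top_of_set I) (subtopology X J) g"
    using homeomorphic_space homeomorphic_space_sym by metis
  have JX: "J \<subseteq> topspace X" using J by (rule openin_subset)
  then have gI: "g ` I = J" using homeomorphic_imp_surjective_map[OF g] by auto
  have gc: "continuous_map (top_of_set I) X g"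
    using homeomorphic_imp_continuous_map[OF g] by (simp add: continuous_map_in_subtopology)
  \<comment> \<open>As \<open>J\<close> is open in \<open>X\<close>, the chart \<open>g\<close> is
    open into \<open>X\<close> itself, so open sets can be chosen in real coordinates.\<close>
  have gop: "openin X (g ` W)" if "open W" "W \<subseteq> I" for W
  proof -
    have "openin (top_of_set I) W" using that I(1) by (simp add: openin_open_eq)
    then have "openin (subtopology X J) (g ` W)"
      using homeomorphic_imp_open_map[OF g] by (simp add: open_map_def)
    then show ?thesis using J by (simp add: openin_open_subtopology)
  qed
  have preop: "open {t \<in> I. g t \<in> W}" if "openin X W" for W
    using openin_continuous_map_preimage[OF gc that] I(1) by (simp add: openin_open_eq)

  have "J \<noteq> {}" using gI I(3) by auto
  then obtain x A where x: "x \<in> J" and A: "minimal_set X f A" "x \<in> A"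
    using nontransitive_in_minimal_set[OF tom J] by metis
  have Acl: "closedin X A" using A(1) by (simp add: minimal_set_def)
  have AX: "openin X (topspace X - A)" using Acl by blast
  have "topspace X - A \<noteq> {}"
  proof
    assume "topspace X - A = {}"
    then have "A = topspace X" using closedin_subset[OF Acl] by blast
    then show False using nm A(1) by (simp add: minimal_set_def minimal_map_def)
  qed
  \<comment> \<open>If \<open>J\<close> lay inside the invariant set \<open>A\<close>, all its
    iterates would too, and none could meet the complement.\<close>
  then obtain n where "(f ^^ n) ` J \<inter> (topspace X - A) \<noteq> {}"
    using trans J AX x unfolding transitive_map_def by blast
  moreover have "f ` A \<subseteq> A" using A(1) by (simp add: minimal_set_def)
  ultimately have "\<not> J \<subseteq> A" using funpow_mem[of f A] by blast
  define W where "W = {t \<in> I. g t \<in> topspace X - A}"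
  have W: "open W" "W \<subseteq> I" unfolding W_def using preop[OF AX] by auto
  have "g ` W \<noteq> {}" using \<open>\<not> J \<subseteq> A\<close> gI JX by (auto simp: W_def)
  then obtain y B where y: "y \<in> g ` W" and B: "minimal_set X f B" "y \<in> B"
    using nontransitive_in_minimal_set[OF tom gop[OF W]] by metis
  then obtain b where b: "b \<in> W" "y = g b" by blast
  \<comment> \<open>Choosing \<open>c\<close> within \<open>e\<close> of \<open>b\<close> keeps the
    whole segment \<open>{b..c}\<close> in \<open>W\<close>, hence its image off
    \<open>A\<close>.\<close>
  then obtain e where e: "e > 0" "cball b e \<subseteq> W" using W(1) open_contains_cball by blast
  then have be: "{b..b+e} \<subseteq> W" by (auto simp: dist_real_def subset_iff)
  have "{b<..<b+e} \<subseteq> {b..b+e}" by auto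
  then have "{b<..<b+e} \<subseteq> I" using be W(2) by blast
  then have "openin X (g ` {b<..<b+e})" by (intro gop) auto
  moreover have "g ` {b<..<b+e} \<noteq> {}" using e(1) by simp
  ultimately obtain z C where z: "z \<in> g ` {b<..<b+e}" and C: "minimal_set X f C" "z \<in> C"
    using nontransitive_in_minimal_set[OF tom] by metis
  then obtain c where c: "b < c" "c < b + e" "z = g c" by auto
  have "{b..c} \<subseteq> {b..b+e}" using c by auto
  then have bcW: "{b..c} \<subseteq> W" using be by blast
  then have bcI: "{b..c} \<subseteq> I" using W(2) by blast
  have bc: "{b..c} = insert b (insert c {b<..<c})" using c by auto
  define D where "D = g ` {b<..<c}"
  have Dop: "openin X D" unfolding D_def using bcI bc by (intro gop) auto
  have "D \<noteq> {}" using c by (simp add: D_def)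
  have "compactin (top_of_set I) {b..c}" using bcI by (auto simp: compactin_subtopology)
  then have "closedin X (g ` {b..c})"
    using compactin_imp_closedin[OF haus] image_compactin gc by metis
  \<comment> \<open>This set and \<open>D\<close> are disjoint and open, and together they miss only
    the two points \<open>g b\<close> and \<open>g c\<close>.\<close>
  then have Eop: "openin X (topspace X - g ` {b..c})" by blast

  have Anot: "g t \<notin> A" if "t \<in> W" for t using that by (simp add: W_def)
  have "y \<notin> A" "z \<notin> A" using b c(3) bcW bc Anot by auto
  \<comment> \<open>If \<open>x\<close> were in \<open>B\<close> or \<open>C\<close>, that set would
    be contained in \<open>A\<close>, contradicting the position of \<open>y\<close> or
    \<open>z\<close>. The sets \<open>B\<close> and \<open>C\<close> themselves may
    coincide.\<close>
  then have disj: "x \<notin> B" "x \<notin> C"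
    using minimal_set_subset[OF B(1) A(1) _ A(2)] minimal_set_subset[OF C(1) A(1) _ A(2)]
      B(2) C(2) by blast+
  define Q where "Q = {t \<in> I. g t \<in> topspace X - (B \<union> C)}"
  have "closedin X (B \<union> C)" using B(1) C(1) by (auto simp: minimal_set_def)
  then have Q: "open Q" unfolding Q_def by (intro preop) blast
  obtain a where a: "a \<in> I" "x = g a" using x gI by blast
  then have "a \<in> Q" using disj x JX by (auto simp: Q_def)
  then obtain r where r: "r > 0" "ball a r \<subseteq> Q" using Q open_contains_ball by blast
  then have rI: "ball a r \<subseteq> I" by (auto simp: Q_def)
  define E where "E = g ` ball a r"
  have "openin X E" unfolding E_def using rI by (intro gop) auto
  moreover have "x \<in> E" using a r by (auto simp: E_def)
  ultimately obtain n where n: "(f ^^ n) ` E \<inter> D \<noteq> {}"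
    using trans Dop \<open>D \<noteq> {}\<close> unfolding transitive_map_def by blast
  have EX: "E \<subseteq> topspace X" using rI gI JX by (auto simp: E_def)
  have fc: "continuous_map X X (f ^^ n)" using cont by (rule continuous_map_funpow)
  have "connectedin (top_of_set I) (ball a r)"
    using rI by (simp add: connectedin_subtopology)
  then have conn: "connectedin X ((f ^^ n) ` E)"
    unfolding E_def using connectedin_continuous_map_image fc gc by metis
  \<comment> \<open>Backward invariance: a point of \<open>E\<close> sent into \<open>B\<close> or
    \<open>C\<close> would already lie there, but \<open>ball a r\<close> was chosen inside
    \<open>Q\<close>.\<close>
  have avoid: "(f ^^ n) ` E \<inter> (B \<union> C) = {}"
  proof -
    have "(f ^^ n) w \<notin> B \<union> C" if "w \<in> E" for w
    proof -
      have "w \<notin> B" "w \<notin> C" using that r by (auto simp: E_def Q_def)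
      moreover have "w \<in> topspace X" using that EX by blast
      ultimately show ?thesis
        using minimal_set_vimage[OF tom B(1)] minimal_set_vimage[OF tom C(1)] by blast
    qed
    then show ?thesis by blast
  qed
  let ?S = "(f ^^ n) ` E" and ?G = "topspace X - g ` {b..c}"
  have sub: "?S \<subseteq> D \<union> ?G"
  proof
    fix w assume w: "w \<in> ?S"
    have "w \<in> topspace X" using w EX continuous_map_image_subset_topspace[OF fc] by blast
    moreover have "w \<noteq> g b" "w \<noteq> g c" using w avoid B(2) C(2) b c by blast+
    ultimately show "w \<in> D \<union> ?G" by (auto simp: D_def bc)
  qed
  have "D \<inter> ?G \<inter> ?S = {}" by (auto simp: D_def bc)
  moreover have "D \<inter> ?S \<noteq> {}" using n by blast
  \<comment> \<open>The connected set \<open>?S\<close> is covered by two disjoint open sets and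
    meets \<open>D\<close>, so it cannot meet the other one.\<close>
  ultimately have "?G \<inter> ?S = {}"
    using connectedinD[OF conn Dop Eop sub] by blast
  \<comment> \<open>The point \<open>x\<close> belongs to both \<open>E\<close> and
    \<open>A\<close>: its iterate lies in \<open>D\<close>, which misses \<open>A\<close>, although
    \<open>A\<close> is forward invariant.\<close>
  then have "(f ^^ n) x \<in> D" using \<open>x \<in> E\<close> sub by blast
  then have "(f ^^ n) x \<notin> A" using Anot bcW bc by (auto simp: D_def)
  moreover have "(f ^^ n) x \<in> A" using A funpow_mem unfolding minimal_set_def by metis
  ultimately show False ..
qed

end
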